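(* Let $B_1$ be a finite simple graph with $2n$ vertices and $q$ edges, where $q$ is even and $\frac{q}{2}=n$. Suppose that $B_1$ has $n$ mutually disjoint $\langle xyz\rangle$ paths such that no cycle of $B_1$ contains an odd number of these paths, and that $B_1$ has a set of $n$ pairwise nonadjacent edges such that each of these edges is in exactly one of the $n$ $\langle xyz\rangle$ paths. Then both $B_1$ and its line graph $L(B_1)$ are 2-variegated graphs; that is, $B_1$ is a solution of the equation $L(B_1)=B_2$ with $B_1$ and $B_2$ both 2-variegated.
   Context: All graphs are finite, without loops or multiple edges. A graph $B$ with $2m$ vertices is 2-variegated (bivariegated) if its vertex set can be partitioned into two parts of equal size $m$ such that each vertex of either part is adjacent to exactly one vertex of the other part (adjacencies inside a part are unrestricted). The line graph $L(G)$ has the edges of $G$ as vertices, two of them being adjacent in $L(G)$ if and only if the corresponding edges of $G$ share an endpoint. An $\langle xyz\rangle$ path in $G$ is a path of length 2 with edges $xy$ and $yz$ on three distinct vertices $x,y,z$ that is an induced subgraph of $G$ (so $x$ and $z$ are not adjacent in $G$) and whose middle vertex $y$ has degree exactly $2$ in $G$. Two paths are disjoint if they have no common edge. Edges are nonadjacent if they share no endpoint. A cycle contains an $\langle xyz\rangle$ path if both edges of the path are edges of the cycle. *)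

theory Defs
  imports Main
begin

text \<open>A graph is a pair of a vertex set and a set of two-element vertex sets, so
  loops, directions and multiple edges cannot occur.\<close>

type_synonym 'a graph = "'a set \<times> 'a set set"

abbreviation verts :: "'a graph \<Rightarrow> 'a set" where
  "verts G \<equiv> fst G"

abbreviation edges :: "'a graph \<Rightarrow> 'a set set" where
  "edges G \<equiv> snd G"

definition simple_graph :: "'a graph \<Rightarrow> bool" where
  "simple_graph G \<longleftrightarrow> finite (verts G) \<and> (\<forall>e\<in>edges G. e \<subseteq> verts G \<and> card e = 2)"

definition degree :: "'a graph \<Rightarrow> 'a \<Rightarrow> nat" where
  "degree G v = card {e \<in> edges G. v \<in> e}"

definition line_graph :: "'a graph \<Rightarrow> 'a set graph" where
  "line_graph G =
     (edges G, {{e, f} | e f. e \<in> edges G \<and> f \<in> edges G \<and> e \<noteq> f \<and> e \<inter> f \<noteq> {}})"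

definition two_variegated :: "'a graph \<Rightarrow> bool" where
  "two_variegated G \<longleftrightarrow> simple_graph G \<and>
     (\<exists>X Y. X \<union> Y = verts G \<and> X \<inter> Y = {} \<and> card X = card Y \<and>
        (\<forall>x\<in>X. \<exists>!y. y \<in> Y \<and> {x, y} \<in> edges G) \<and>
        (\<forall>y\<in>Y. \<exists>!x. x \<in> X \<and> {x, y} \<in> edges G))"

text \<open>A path of length two is given by a triple of vertices. The triples \<open>(x, y, z)\<close> and
  \<open>(z, y, x)\<close> denote the same path; they have the same edges, so a family of triples that is
  pairwise edge-disjoint contains at most one of them and its cardinality counts paths.\<close>

fun path_edges :: "'a \<times> 'a \<times> 'a \<Rightarrow> 'a set set" where
  "path_edges (x, y, z) = {{x, y}, {y, z}}"

fun xyz_path :: "'a graph \<Rightarrow> 'a \<times> 'a \<times> 'a \<Rightarrow> bool" where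
  "xyz_path G (x, y, z) \<longleftrightarrow>
     distinct [x, y, z] \<and> {x, y} \<in> edges G \<and> {y, z} \<in> edges G \<and> {x, z} \<notin> edges G \<and>
     degree G y = 2"

text \<open>A cycle is the list of its distinct vertices in cyclic order.\<close>

definition cycle_edges :: "'a list \<Rightarrow> 'a set set" where
  "cycle_edges c = {{c ! i, c ! (Suc i mod length c)} | i. i < length c}"

definition is_cycle :: "'a graph \<Rightarrow> 'a list \<Rightarrow> bool" where
  "is_cycle G c \<longleftrightarrow> 3 \<le> length c \<and> distinct c \<and> cycle_edges c \<subseteq> edges G"

end

theory Submission
  imports Defs
begin

text \<open>By counting, the \<open>n\<close> paths partition the \<open>2n\<close> edges, their middle vertices are \<open>n\<close> distinct
  vertices, and \<open>M\<close> is a perfect matching that joins each middle vertex to one of the remaining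
  \<open>n\<close> vertices. Index both kinds of vertices by the paths: path \<open>i\<close> runs from \<open>a i\<close> along its
  matching edge to its middle \<open>m i\<close> and on to \<open>a (F i)\<close> for a function \<open>F\<close> on the paths. A
  periodic orbit of \<open>F\<close> is a cycle of the graph through as many paths as the period, so all periods
  are even and the paths admit a 2-colouring that \<open>F\<close> flips. For \<open>B1\<close>, colour \<open>a i\<close> like \<open>i\<close>
  and \<open>m i\<close> oppositely: the bichromatic edges are those of \<open>M\<close>. For the line graph, colour the edge
  from \<open>a i\<close> to \<open>m i\<close> like \<open>i\<close> and the edge from \<open>m i\<close> to \<open>a (F i)\<close> like \<open>F i\<close>: all edges at
  \<open>a i\<close> agree, so the only bichromatic adjacencies are those inside a path.\<close>

section \<open>Colourings flipped by a function\<close>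

lemma funpow_closed:
  assumes "\<And>i. i \<in> I \<Longrightarrow> F i \<in> I" and "i \<in> I"
  shows "(F ^^ t) i \<in> I"
  using assms by (induction t) auto

text \<open>If \<open>s < t < k\<close> gave the same point, applying \<open>F ^^ (k - t)\<close> to
  both sides would return to \<open>i\<close> after \<open>k - t + s < k\<close> steps, against the
  minimality of \<open>k\<close>.\<close>

lemma funpow_inj_below_period:
  assumes per: "(F ^^ k) i = i"
    and min: "\<And>l. 0 < l \<Longrightarrow> l < k \<Longrightarrow> (F ^^ l) i \<noteq> i"
  shows "inj_on (\<lambda>t. (F ^^ t) i) {..<k}"
proof -
  have neq: "(F ^^ s) i \<noteq> (F ^^ t) i" if "s < t" "t < k" for s t
  proof
    assume eq: "(F ^^ s) i = (F ^^ t) i"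
    have "(F ^^ (k - t + s)) i = (F ^^ (k - t)) ((F ^^ t) i)"
      by (simp add: funpow_add eq)
    also have "\<dots> = (F ^^ k) i"
      using that by (metis add_diff_inverse_nat add.commute comp_apply funpow_add
          less_imp_le_nat not_le)
    finally have "(F ^^ (k - t + s)) i = i"
      using per by simp
    moreover have "0 < k - t + s" "k - t + s < k"
      using that by linarith+
    ultimately show False
      using min[of "k - t + s"] by simp
  qed
  show ?thesis
    by (rule linorder_inj_onI) (auto dest: neq)
qed

text \<open>The least positive period divides every period. Evenness is assumed for least periods
  alone, since these are the ones that yield cycles with distinct vertices.\<close>

lemma even_period:
  assumes min: "\<And>k. 0 < k \<Longrightarrow> (F ^^ k) i = i \<Longrightarrow>
      (\<And>l. 0 < l \<Longrightarrow> l < k \<Longrightarrow> (F ^^ l) i \<noteq> i) \<Longrightarrow> even k"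
    and per: "(F ^^ d) i = i"
  shows "even (d :: nat)"
proof (cases "d = 0")
  case False
  define k where "k = (LEAST k. 0 < k \<and> (F ^^ k) i = i)"
  have k: "0 < k \<and> (F ^^ k) i = i"
    unfolding k_def by (rule LeastI[of _ d]) (use False per in simp)
  have least: "(F ^^ l) i \<noteq> i" if "0 < l" "l < k" for l
    using not_less_Least[of l "\<lambda>k. 0 < k \<and> (F ^^ k) i = i"] that by (auto simp: k_def)
  have "(F ^^ (d mod k)) i = i"
    using k per by (simp add: funpow_mod_eq)
  then have "k dvd d"
    using least[of "d mod k"] k by (auto simp: dvd_eq_mod_eq_0)
  moreover have "even k"
    using min k least by blast
  ultimately show ?thesis
    by (rule dvd_trans[rotated])
qed simp

text \<open>Colour \<open>v\<close> by the parity of \<open>x + y\<close> in an equation \<open>F\<^sup>x v = F\<^sup>y r\<close>, with \<open>r\<close> a chosen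
  representative of the component of \<open>v\<close> in the functional graph.\<close>

lemma flipping_colouring_exists:
  fixes F :: "'i \<Rightarrow> 'i"
  assumes closed: "\<And>i. i \<in> I \<Longrightarrow> F i \<in> I"
    and even: "\<And>i k. i \<in> I \<Longrightarrow> 0 < k \<Longrightarrow> (F ^^ k) i = i \<Longrightarrow>
      (\<And>l. 0 < l \<Longrightarrow> l < k \<Longrightarrow> (F ^^ l) i \<noteq> i) \<Longrightarrow> even k"
  shows "\<exists>col :: 'i \<Rightarrow> bool. \<forall>i\<in>I. col (F i) \<longleftrightarrow> \<not> col i"
proof -
  have parity_le: "even x \<longleftrightarrow> even y"
    if "i \<in> I" "(F ^^ x) i = (F ^^ y) i" "x \<le> y" for i x y
  proof -
    have I: "(F ^^ x) i \<in> I"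
      using closed that(1) by (rule funpow_closed)
    \<comment> \<open>The point \<open>(F ^^ x) i\<close> is periodic, and \<open>y - x\<close> is
      one of its periods.\<close>
    have "even (y - x)"
    proof (rule even_period[where F = F and i = "(F ^^ x) i"])
      show "(F ^^ (y - x)) ((F ^^ x) i) = (F ^^ x) i"
        using that by (metis comp_apply funpow_add le_add_diff_inverse2)
    next
      fix k
      assume "0 < k" "(F ^^ k) ((F ^^ x) i) = (F ^^ x) i"
        "\<And>l. 0 < l \<Longrightarrow> l < k \<Longrightarrow> (F ^^ l) ((F ^^ x) i) \<noteq> (F ^^ x) i"
      with I show "even k"
        by (rule even)
    qed
    then show ?thesis
      using that(3) by auto
  qed
  have parity: "even x \<longleftrightarrow> even y" if "i \<in> I" "(F ^^ x) i = (F ^^ y) i" for i x y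
  proof (cases "x \<le> y")
    case True
    with that show ?thesis
      by (rule parity_le)
  next
    case False
    then show ?thesis
      using parity_le[OF that(1) that(2)[symmetric]] by simp
  qed
  define C where "C v = {w \<in> I. \<exists>x y. (F ^^ x) v = (F ^^ y) w}" for v
  \<comment> \<open>The choice depends on \<open>v\<close> only through the set \<open>C v\<close>,
    so \<open>C (F v) = C v\<close> forces \<open>r (F v) = r v\<close>.\<close>
  define r where "r v = (SOME w. w \<in> C v)" for v
  define col where "col v \<longleftrightarrow> (\<exists>x y. (F ^^ x) v = (F ^^ y) (r v) \<and> even (x + y))" for v
  have r: "r v \<in> I" "\<exists>x y. (F ^^ x) v = (F ^^ y) (r v)" if "v \<in> I" for v
  proof -
    have "v \<in> C v"
      using that by (auto simp: C_def)
    then have "r v \<in> C v"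
      unfolding r_def by (rule someI)
    then show "r v \<in> I" "\<exists>x y. (F ^^ x) v = (F ^^ y) (r v)"
      by (auto simp: C_def)
  qed
  have C_step: "C (F v) = C v" for v
  proof -
    have "(\<exists>x y. (F ^^ x) (F v) = (F ^^ y) w) \<longleftrightarrow> (\<exists>x y. (F ^^ x) v = (F ^^ y) w)" for w
    proof
      assume "\<exists>x y. (F ^^ x) (F v) = (F ^^ y) w"
      then obtain x y where "(F ^^ x) (F v) = (F ^^ y) w"
        by blast
      then have "(F ^^ Suc x) v = (F ^^ y) w"
        by (simp add: funpow_swap1)
      then show "\<exists>x y. (F ^^ x) v = (F ^^ y) w"
        by blast
    next
      assume "\<exists>x y. (F ^^ x) v = (F ^^ y) w"
      then obtain x y where "(F ^^ x) v = (F ^^ y) w"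
        by blast
      then have "(F ^^ x) (F v) = (F ^^ Suc y) w"
        by (metis comp_apply funpow.simps(2) funpow_swap1)
      then show "\<exists>x y. (F ^^ x) (F v) = (F ^^ y) w"
        by blast
    qed
    then show ?thesis
      by (simp add: C_def)
  qed
  have col_iff: "col v \<longleftrightarrow> even (x + y)"
    if v: "v \<in> I" and eq: "(F ^^ x) v = (F ^^ y) (r v)" for v x y
  proof -
    have "even (x + y) \<longleftrightarrow> even (x' + y')" if eq': "(F ^^ x') v = (F ^^ y') (r v)" for x' y'
    proof -
      \<comment> \<open>Apply \<open>F ^^ x'\<close> to the first equation and \<open>F ^^ x\<close>
        to the second: both left sides become the same iterate of \<open>v\<close>, so
        \<open>parity\<close> can compare the exponents at \<open>r v\<close>.\<close>
      have "(F ^^ (x' + y)) (r v) = (F ^^ (x' + x)) v"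
        by (simp add: funpow_add eq)
      also have "\<dots> = (F ^^ (x + y')) (r v)"
        by (metis add.commute comp_apply eq' funpow_add)
      finally have "even (x' + y) \<longleftrightarrow> even (x + y')"
        using parity r(1) v by blast
      then show ?thesis
        by auto
    qed
    then show ?thesis
      using eq unfolding col_def by blast
  qed
  have "col (F v) \<longleftrightarrow> \<not> col v" if v: "v \<in> I" for v
  proof -
    obtain x y where "(F ^^ x) (F v) = (F ^^ y) (r (F v))"
      using r(2)[OF closed[OF v]] by blast
    moreover from this have "(F ^^ Suc x) v = (F ^^ y) (r v)"
      by (simp add: r_def C_step funpow_swap1)
    ultimately show ?thesis
      using col_iff[OF closed[OF v]] col_iff[OF v] by (metis add_Suc even_Suc)
  qed
  then show ?thesis
    by blast
qed

section \<open>Subdivided functional graphs\<close>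

text \<open>Indexing both parts by one set turns the matching between them into the diagonal; the
  parts have equal size because both indexings are injective.\<close>

lemma two_variegatedI:
  assumes "simple_graph G"
    and "verts G = u ` I \<union> w ` I" and "u ` I \<inter> w ` I = {}"
    and inj: "inj_on u I" "inj_on w I"
    and adj: "\<And>i j. i \<in> I \<Longrightarrow> j \<in> I \<Longrightarrow> {u i, w j} \<in> edges G \<longleftrightarrow> i = j"
  shows "two_variegated G"
proof -
  have "\<forall>x\<in>u ` I. \<exists>!y. y \<in> w ` I \<and> {x, y} \<in> edges G"
    using adj by blast
  moreover have "\<forall>y\<in>w ` I. \<exists>!x. x \<in> u ` I \<and> {x, y} \<in> edges G"
    using adj by blast
  moreover have "card (u ` I) = card (w ` I)"
    using inj by (simp add: card_image)
  ultimately show ?thesis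
    using assms(1-3) unfolding two_variegated_def
    by (intro conjI exI[of _ "u ` I"] exI[of _ "w ` I"]) simp_all
qed

lemma image_swap_Un:
  "(\<lambda>i. if c i then u i else w i) ` I \<union> (\<lambda>i. if c i then w i else u i) ` I = u ` I \<union> w ` I"
proof -
  have pairs: "f ` I \<union> g ` I = (\<Union>i\<in>I. {f i, g i})" for f g :: "'b \<Rightarrow> 'a"
    by blast
  show ?thesis
    unfolding pairs by (rule SUP_cong) auto
qed

lemma simple_graph_line_graph:
  assumes "finite (edges G)"
  shows "simple_graph (line_graph G)"
proof -
  have "card {e, f} = 2" if "e \<noteq> f" for e f :: "'a set"
    using that by simp
  then show ?thesis
    using assms by (auto simp: simple_graph_def line_graph_def simp del: card_insert_disjoint)
qed

text \<open>The functional graph of \<open>F\<close> on the vertices \<open>a i\<close>, with each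
  edge from \<open>a i\<close> to \<open>a (F i)\<close> subdivided by a new vertex
  \<open>m i\<close>. A fixed point of \<open>F\<close> would produce a double edge; a 2-cycle of
  \<open>F\<close> becomes a 4-cycle.\<close>

locale subdivided_functional_graph =
  fixes G :: "'a graph" and I :: "'i set" and F :: "'i \<Rightarrow> 'i" and a m :: "'i \<Rightarrow> 'a"
  assumes simple: "simple_graph G"
    and verts_eq: "verts G = a ` I \<union> m ` I"
    and edges_eq: "edges G = (\<Union>i\<in>I. {{a i, m i}, {m i, a (F i)}})"
    and inj_a: "inj_on a I" and inj_m: "inj_on m I"
    and disj: "a ` I \<inter> m ` I = {}"
    and F_closed: "i \<in> I \<Longrightarrow> F i \<in> I"
    and F_neq: "i \<in> I \<Longrightarrow> F i \<noteq> i"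
begin

lemma a_neq_m: "i \<in> I \<Longrightarrow> j \<in> I \<Longrightarrow> a i \<noteq> m j"
  using disj by blast

lemma a_eq_iff: "i \<in> I \<Longrightarrow> j \<in> I \<Longrightarrow> a i = a j \<longleftrightarrow> i = j"
  using inj_a by (auto dest: inj_onD)

lemma m_eq_iff: "i \<in> I \<Longrightarrow> j \<in> I \<Longrightarrow> m i = m j \<longleftrightarrow> i = j"
  using inj_m by (auto dest: inj_onD)

lemmas label_simps = a_neq_m a_neq_m[symmetric] a_eq_iff m_eq_iff F_closed F_neq F_neq[symmetric]

text \<open>The cycle visits the points of the orbit in order, alternating \<open>a\<close> and
  \<open>m\<close>; its \<open>2 * k\<close> vertices are distinct because \<open>k\<close> is the
  least period.\<close>

lemma cycle_of_period:
  assumes i: "i \<in> I" and "0 < k" and per: "(F ^^ k) i = i"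
    and min: "\<And>l. 0 < l \<Longrightarrow> l < k \<Longrightarrow> (F ^^ l) i \<noteq> i"
  obtains c where "is_cycle G c"
    and "cycle_edges c = (\<Union>j\<in>(\<lambda>t. (F ^^ t) i) ` {..<k}. {{a j, m j}, {m j, a (F j)}})"
proof
  define p where "p t = (F ^^ t) i" for t
  have pI: "p t \<in> I" for t
    unfolding p_def by (rule funpow_closed) (use F_closed i in auto)
  have p_Suc: "p (Suc t) = F (p t)" for t
    by (simp add: p_def)
  have p_k: "p k = p 0"
    using per by (simp add: p_def)
  have p_inj: "p s = p t \<longleftrightarrow> s = t" if "s < k" "t < k" for s t
    using funpow_inj_below_period[OF per min] that by (auto simp: p_def dest: inj_onD)
  \<comment> \<open>Without fixed points the cycle has at least 4 vertices, as
    \<open>is_cycle\<close> requires at least 3.\<close>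
  have "k \<noteq> 1"
    using per F_neq[OF i] by auto
  then have k2: "2 \<le> k"
    using \<open>0 < k\<close> by linarith
  define g where "g j = (if even j then a (p (j div 2)) else m (p (j div 2)))" for j
  define c where "c = map g [0..<2 * k]"
  have len: "length c = 2 * k"
    by (simp add: c_def)
  have "inj_on g {0..<2 * k}"
  proof (rule inj_onI)
    fix x y
    assume "x \<in> {0..<2 * k}" "y \<in> {0..<2 * k}" and eq: "g x = g y"
    then have "x div 2 < k" "y div 2 < k"
      by auto
    then have "x div 2 = y div 2" "even x \<longleftrightarrow> even y"
      using eq pI by (auto simp: g_def label_simps p_inj split: if_splits)
    then show "x = y"
      by (metis dvd_mult_div_cancel odd_two_times_div_two_succ)
  qed
  then have "distinct c"
    by (simp add: c_def distinct_map)
  have even_edge: "{c ! (2 * t), c ! (Suc (2 * t) mod length c)} = {a (p t), m (p t)}"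
    if "t < k" for t
    using that by (simp add: len c_def g_def)
  have odd_edge: "{c ! Suc (2 * t), c ! (Suc (Suc (2 * t)) mod length c)}
      = {m (p t), a (F (p t))}" if t: "t < k" for t
  \<comment> \<open>At the last path the index wraps around to 0, and \<open>p k = p 0\<close>
    closes the cycle.\<close>
  proof (cases "Suc t = k")
    case True
    then have "Suc (Suc (2 * t)) mod length c = 0"
      by (auto simp: len)
    then show ?thesis
      using t k2 True p_k p_Suc[of t] by (simp add: c_def g_def)
  next
    case False
    then have "Suc (Suc (2 * t)) < 2 * k"
      using t by linarith
    then show ?thesis
      using t p_Suc[of t] by (simp add: len c_def g_def)
  qed
  have "cycle_edges c = (\<Union>t<k. {{a (p t), m (p t)}, {m (p t), a (F (p t))}})" (is "?L = ?R")
  proof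
    show "?L \<subseteq> ?R"
    proof
      fix e
      assume "e \<in> ?L"
      then obtain j where j: "j < 2 * k" and e: "e = {c ! j, c ! (Suc j mod length c)}"
        by (auto simp: cycle_edges_def len)
      have t: "j div 2 < k"
        using j by auto
      show "e \<in> ?R"
      proof (cases "even j")
        case True
        then show ?thesis
          using even_edge[OF t] e t by auto
      next
        case False
        then have "Suc (2 * (j div 2)) = j"
          by simp
        then have "e = {m (p (j div 2)), a (F (p (j div 2)))}"
          using odd_edge[OF t] e by simp
        then show ?thesis
          using t by blast
      qed
    qed
    show "?R \<subseteq> ?L"
    proof
      fix e
      assume "e \<in> ?R"
      then obtain t where t: "t < k"
        and "e = {a (p t), m (p t)} \<or> e = {m (p t), a (F (p t))}"
        by blast
      then have "e = {c ! (2 * t), c ! (Suc (2 * t) mod length c)} \<or>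
          e = {c ! Suc (2 * t), c ! (Suc (Suc (2 * t)) mod length c)}"
        using even_edge odd_edge by simp
      moreover have "2 * t < length c" "Suc (2 * t) < length c"
        using t by (auto simp: len)
      ultimately show "e \<in> ?L"
        unfolding cycle_edges_def by blast
    qed
  qed
  then show edges_c: "cycle_edges c =
      (\<Union>j\<in>(\<lambda>t. (F ^^ t) i) ` {..<k}. {{a j, m j}, {m j, a (F j)}})"
    by (simp add: p_def)
  have "cycle_edges c \<subseteq> edges G"
    unfolding edges_c edges_eq using pI by (fastforce simp: p_def)
  then show "is_cycle G c"
    using \<open>distinct c\<close> k2 by (simp add: is_cycle_def len)
qed

text \<open>The vertices \<open>m i\<close> and \<open>a (F i)\<close> lie in the same part, since
  both are coloured opposite to \<open>i\<close>. Only the edges from \<open>a i\<close> to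
  \<open>m i\<close> cross.\<close>

lemma two_variegated_of_colouring:
  assumes col: "\<And>i. i \<in> I \<Longrightarrow> col (F i) \<longleftrightarrow> \<not> col i"
  shows "two_variegated G"
proof (rule two_variegatedI[of G "\<lambda>i. if col i then a i else m i" I
      "\<lambda>i. if col i then m i else a i"])
  fix i j
  assume ij: "i \<in> I" "j \<in> I"
  have "{a i, m j} \<in> edges G \<longleftrightarrow> i = j \<or> i = F j" if "i \<in> I" "j \<in> I" for i j
    using that by (auto simp: edges_eq doubleton_eq_iff label_simps)
  from this[OF ij] this[OF ij(2,1)]
  have "{a i, m j} \<in> edges G \<longleftrightarrow> i = j \<or> i = F j" "{m i, a j} \<in> edges G \<longleftrightarrow> i = j \<or> j = F i"
    by (auto simp: insert_commute)
  moreover have "{a i, a j} \<notin> edges G" "{m i, m j} \<notin> edges G"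
    using ij by (auto simp: edges_eq doubleton_eq_iff label_simps)
  ultimately show "{if col i then a i else m i, if col j then m j else a j} \<in> edges G \<longleftrightarrow> i = j"
    using col[OF ij(1)] col[OF ij(2)] by auto
next
  show "(\<lambda>i. if col i then a i else m i) ` I \<inter> (\<lambda>i. if col i then m i else a i) ` I = {}"
    by (auto simp: label_simps)
next
  show "verts G = (\<lambda>i. if col i then a i else m i) ` I \<union> (\<lambda>i. if col i then m i else a i) ` I"
    unfolding verts_eq by (rule image_swap_Un[symmetric])
next
  show "inj_on (\<lambda>i. if col i then a i else m i) I" "inj_on (\<lambda>i. if col i then m i else a i) I"
    by (auto intro!: inj_onI simp: label_simps split: if_splits)
qed (rule simple)

text \<open>Every edge at \<open>a j\<close> is in the part determined by \<open>col j\<close>: it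
  is either \<open>e j\<close> or some \<open>f i\<close> with \<open>F i = j\<close>. Adjacencies
  across the parts thus arise only at a vertex \<open>m i\<close>, whose two edges are
  \<open>e i\<close> and \<open>f i\<close>.\<close>

lemma two_variegated_line_graph_of_colouring:
  assumes col: "\<And>i. i \<in> I \<Longrightarrow> col (F i) \<longleftrightarrow> \<not> col i"
  shows "two_variegated (line_graph G)"
proof -
  define e where "e i = {a i, m i}" for i
  define f where "f i = {m i, a (F i)}" for i
  have e_eq: "e i = e j \<longleftrightarrow> i = j" and f_eq: "f i = f j \<longleftrightarrow> i = j" and ef: "e i \<noteq> f j"
    if "i \<in> I" "j \<in> I" for i j
    using that by (auto simp: e_def f_def doubleton_eq_iff label_simps)
  have edges: "edges G = e ` I \<union> f ` I"
    by (auto simp: edges_eq e_def f_def)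
  have adj: "{x, y} \<in> edges (line_graph G) \<longleftrightarrow> x \<noteq> y \<and> x \<inter> y \<noteq> {}"
    if "x \<in> edges G" "y \<in> edges G" for x y
    using that by (auto simp: line_graph_def doubleton_eq_iff)
  have ee: "e i \<inter> e j \<noteq> {} \<longleftrightarrow> i = j" and ff: "f i \<inter> f j \<noteq> {} \<longleftrightarrow> i = j \<or> F i = F j"
    and ef': "e i \<inter> f j \<noteq> {} \<longleftrightarrow> i = j \<or> i = F j"
    if "i \<in> I" "j \<in> I" for i j
    using that by (auto simp: e_def f_def label_simps)
  have "edges G \<subseteq> Pow (verts G)" "finite (verts G)"
    using simple by (auto simp: simple_graph_def)
  then have "finite (edges G)"
    by (simp add: finite_subset)
  then have "simple_graph (line_graph G)"
    by (rule simple_graph_line_graph)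
  then show ?thesis
  proof (rule two_variegatedI[of _ "\<lambda>i. if col i then e i else f i" I
        "\<lambda>i. if col i then f i else e i"])
    fix i j
    assume ij: "i \<in> I" "j \<in> I"
    have ends: "e i \<in> edges G" "f i \<in> edges G" "e j \<in> edges G" "f j \<in> edges G"
      using ij by (auto simp: edges)
    \<comment> \<open>Two edges \<open>f i\<close> and \<open>f j\<close> are compared across the
      parts only when \<open>i\<close> and \<open>j\<close> have different colours; then
      \<open>F i = F j\<close> is impossible because \<open>F\<close> flips colours.\<close>
    have "{e i, e j} \<notin> edges (line_graph G)"
      "{f i, f j} \<in> edges (line_graph G) \<longrightarrow> F i = F j"
      "{e i, f j} \<in> edges (line_graph G) \<longleftrightarrow> i = j \<or> i = F j"
      unfolding adj[OF ends(1,3)] adj[OF ends(2,4)] adj[OF ends(1,4)]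
      using ee[OF ij] ff[OF ij] ef'[OF ij] ef[OF ij] by auto
    moreover have "{f i, e j} \<in> edges (line_graph G) \<longleftrightarrow> i = j \<or> j = F i"
      unfolding adj[OF ends(2,3)] using ef'[OF ij(2,1)] ef[OF ij(2,1)] by (auto simp: Int_commute)
    ultimately show "{if col i then e i else f i, if col j then f j else e j}
        \<in> edges (line_graph G) \<longleftrightarrow> i = j"
      using col[OF ij(1)] col[OF ij(2)] by (cases "col i"; cases "col j") auto
  next
    show "verts (line_graph G) = (\<lambda>i. if col i then e i else f i) ` I
        \<union> (\<lambda>i. if col i then f i else e i) ` I"
      unfolding image_swap_Un by (simp add: line_graph_def edges)
  next
    show "(\<lambda>i. if col i then e i else f i) ` I \<inter> (\<lambda>i. if col i then f i else e i) ` I = {}"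
      by (auto simp: e_eq f_eq ef ef[symmetric] split: if_splits)
  next
    show "inj_on (\<lambda>i. if col i then e i else f i) I" "inj_on (\<lambda>i. if col i then f i else e i) I"
      by (auto intro!: inj_onI simp: e_eq f_eq ef ef[symmetric] split: if_splits)
  qed
qed

end

section \<open>Counting\<close>

text \<open>The middle is the common vertex of the two edges, whichever end the triple starts from.
  Having degree 2, it meets no edge outside the path.\<close>

lemma edges_at_path_middle:
  assumes "xyz_path G p" and "path_edges p = {{x, y}, {y, z}}"
    and "x \<noteq> y" "y \<noteq> z" "x \<noteq> z"
  shows "{e \<in> edges G. y \<in> e} = path_edges p"
proof -
  obtain x' y' z' where p: "p = (x', y', z')"
    by (cases p)
  have eq: "{{x', y'}, {y', z'}} = {{x, y}, {y, z}}"
    using assms(2) p by simp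
  have "{x', y'} \<in> {{x, y}, {y, z}}" "{y', z'} \<in> {{x, y}, {y, z}}"
    unfolding eq[symmetric] by simp_all
  moreover have "x' \<noteq> z'" "x' \<noteq> y'" "y' \<noteq> z'"
    using assms(1) p by auto
  ultimately have "y' = y"
    using assms(3-5) by (auto simp: doubleton_eq_iff)
  have card2: "card {e \<in> edges G. y \<in> e} = 2"
    using assms(1) p \<open>y' = y\<close> by (simp add: degree_def)
  then have fin: "finite {e \<in> edges G. y \<in> e}"
    by (metis card.infinite zero_neq_numeral)
  have sub: "path_edges p \<subseteq> {e \<in> edges G. y \<in> e}"
    using assms(1) p \<open>y' = y\<close> by auto
  have "{x, y} \<noteq> {y, z}"
    using assms(3-5) by (auto simp: doubleton_eq_iff)
  then have "card (path_edges p) = 2"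
    unfolding assms(2) by simp
  then show ?thesis
    using card_subset_eq[OF fin sub] card2 by simp
qed

theorem corollary1p1:
  fixes B1 :: "'a graph" and n q :: nat
    and P :: "('a \<times> 'a \<times> 'a) set" and M :: "'a set set"
  assumes "simple_graph B1"
    and "card (verts B1) = 2 * n"
    and "card (edges B1) = q"
    and "even q"
    and "q div 2 = n"
    and "\<And>p. p \<in> P \<Longrightarrow> xyz_path B1 p"
    and "card P = n"
    and "pairwise (\<lambda>p p'. path_edges p \<inter> path_edges p' = {}) P"
    and "\<And>c. is_cycle B1 c \<Longrightarrow> \<not> odd (card {p \<in> P. path_edges p \<subseteq> cycle_edges c})"
    and "M \<subseteq> edges B1"
    and "card M = n"
    and "pairwise disjnt M"
    and "\<And>e. e \<in> M \<Longrightarrow> \<exists>!p. p \<in> P \<and> e \<in> path_edges p"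
  shows "two_variegated B1 \<and> two_variegated (line_graph B1)"
proof -
  have finV: "finite (verts B1)"
    using assms(1) by (simp add: simple_graph_def)
  have edges_sub: "edges B1 \<subseteq> Pow (verts B1)"
    using assms(1) by (auto simp: simple_graph_def)
  then have finE: "finite (edges B1)"
    using finV by (simp add: finite_subset)
  have path_sub: "path_edges p \<subseteq> edges B1" if "p \<in> P" for p
    using assms(6)[OF that] by (cases p) auto
  have same_path: "p = p'" if "p \<in> P" "p' \<in> P" "e \<in> path_edges p" "e \<in> path_edges p'" for p p' e
    using assms(8) that unfolding pairwise_def by blast
  \<comment> \<open>An infinite set has cardinality 0, so \<open>card P = n\<close> does not settle
    the case \<open>n = 0\<close>; edge-disjointness embeds \<open>P\<close> into the finite power
    set of the edges.\<close>
  have finP: "finite P"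
  proof (rule inj_on_finite)
    show "inj_on path_edges P"
      by (rule inj_onI) (metis insertI1 path_edges.elims same_path)
    show "path_edges ` P \<subseteq> Pow (edges B1)"
      using path_sub by auto
  qed (use finE in simp)

  \<comment> \<open>Assigning the matching edges to the paths\<close>
  define h where "h e = (THE p. p \<in> P \<and> e \<in> path_edges p)" for e
  have h: "h e \<in> P" "e \<in> path_edges (h e)" if "e \<in> M" for e
    using theI'[OF assms(13)[OF that]] by (auto simp: h_def)
  have path_edges_meet: "e \<inter> e' \<noteq> {}" if "e \<in> path_edges p" "e' \<in> path_edges p" for e e' p
    using that by (cases p) auto
  have matching_edge_unique: "e = e'"
    if "e \<in> M" "e' \<in> M" "e \<in> path_edges p" "e' \<in> path_edges p" for e e' p
    using that path_edges_meet[of e p e'] assms(12) by (auto simp: pairwise_def disjnt_def)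
  \<comment> \<open>The two edges of a path meet, so a path holds at most one matching edge; equal
    cardinalities then make \<open>h\<close> a bijection onto \<open>P\<close>.\<close>
  have "inj_on h M"
    by (rule inj_onI) (metis h(2) matching_edge_unique)
  then have h_onto: "h ` M = P"
    using h(1) assms(7,11) by (intro card_subset_eq finP) (auto simp: card_image)

  \<comment> \<open>Each path is reversed if necessary, so that its first edge is the one in
    \<open>M\<close>.\<close>
  have "\<exists>x y z. path_edges p = {{x, y}, {y, z}} \<and> x \<noteq> y \<and> y \<noteq> z \<and> x \<noteq> z \<and> {x, y} \<in> M"
    if p: "p \<in> P" for p
  proof -
    obtain x y z where xyz: "p = (x, y, z)"
      by (cases p)
    have "distinct [x, y, z]"
      using assms(6)[OF p] xyz by simp
    obtain e where "e \<in> M" "e \<in> path_edges p"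
      using h_onto h(2) p by blast
    then consider "{x, y} \<in> M" | "{z, y} \<in> M"
      using xyz by (auto simp: insert_commute)
    then show ?thesis
    proof cases
      case 1
      then show ?thesis
        using xyz \<open>distinct [x, y, z]\<close> by auto
    next
      case 2
      moreover have "path_edges p = {{z, y}, {y, x}}"
        using xyz by (simp add: insert_commute)
      moreover have "z \<noteq> y" "y \<noteq> x" "z \<noteq> x"
        using \<open>distinct [x, y, z]\<close> by auto
      ultimately show ?thesis
        by blast
    qed
  qed
  then obtain a m z where edges_p: "\<And>p. p \<in> P \<Longrightarrow> path_edges p = {{a p, m p}, {m p, z p}}"
    and neq: "\<And>p. p \<in> P \<Longrightarrow> a p \<noteq> m p \<and> m p \<noteq> z p \<and> a p \<noteq> z p"
    and inM: "\<And>p. p \<in> P \<Longrightarrow> {a p, m p} \<in> M"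
    by metis

  \<comment> \<open>Vertices and edges in terms of the paths\<close>
  have at_m: "e \<in> path_edges p" if "p \<in> P" "e \<in> edges B1" "m p \<in> e" for p e
    using edges_at_path_middle[OF assms(6)[OF that(1)] edges_p[OF that(1)]] neq that
    by blast
  have in_edges: "{a p, m p} \<in> edges B1" "{m p, z p} \<in> edges B1" if "p \<in> P" for p
    using path_sub[OF that] edges_p[OF that] by auto
  have inj_m: "inj_on m P"
  proof (rule inj_onI)
    fix p p'
    assume p: "p \<in> P" "p' \<in> P" "m p = m p'"
    then show "p = p'"
      using at_m[of p' "{a p, m p}"] in_edges[of p] edges_p[of p] same_path[of p p'] by auto
  qed
  \<comment> \<open>If an end of \<open>p\<close> were the middle of \<open>p'\<close>, an edge of
    \<open>p\<close> would lie in \<open>p'\<close>; then \<open>p = p'\<close>, and an end of a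
    path would be its own middle.\<close>
  have a_neq_m: "a p \<noteq> m p'" if "p \<in> P" "p' \<in> P" for p p'
    using at_m[of p' "{a p, m p}"] in_edges[of p] edges_p[of p] same_path[of p p'] neq that
    by (metis insertI1)
  have z_neq_m: "z p \<noteq> m p'" if "p \<in> P" "p' \<in> P" for p p'
    using at_m[of p' "{m p, z p}"] in_edges[of p] edges_p[of p] same_path[of p p'] neq that
    by (metis insertI1 insertI2)
  have inj_a: "inj_on a P"
  proof (rule inj_onI)
    fix p p'
    assume p: "p \<in> P" "p' \<in> P" "a p = a p'"
    then have "\<not> disjnt {a p, m p} {a p', m p'}"
      by (simp add: disjnt_def)
    then have "{a p, m p} = {a p', m p'}"
      using pairwiseD[OF assms(12) inM[OF p(1)] inM[OF p(2)]] by argo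
    then show "p = p'"
      using same_path[of p p' "{a p, m p}"] edges_p p(1,2) by simp
  qed
  have disj: "a ` P \<inter> m ` P = {}"
    using a_neq_m by blast
  \<comment> \<open>The \<open>n\<close> starts and the \<open>n\<close> middles already account for
    all \<open>2 * n\<close> vertices; below, the \<open>n\<close> disjoint pairs of edges exhaust
    the \<open>q = 2 * n\<close> edges in the same way.\<close>
  have verts_eq: "verts B1 = a ` P \<union> m ` P"
  proof (rule card_subset_eq[symmetric, OF finV])
    show "a ` P \<union> m ` P \<subseteq> verts B1"
      using in_edges edges_sub by blast
    show "card (a ` P \<union> m ` P) = card (verts B1)"
      using disj inj_a inj_m finP assms(2,7) by (simp add: card_Un_disjoint card_image)
  qed
  have edges_eq: "edges B1 = (\<Union>p\<in>P. path_edges p)"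
  proof (rule card_subset_eq[symmetric, OF finE])
    show "(\<Union>p\<in>P. path_edges p) \<subseteq> edges B1"
      using path_sub by blast
    have card_path: "card (path_edges p) = 2" if "p \<in> P" for p
    proof -
      have "{a p, m p} \<noteq> {m p, z p}"
        using neq[OF that] by (auto simp: doubleton_eq_iff)
      then show ?thesis
        unfolding edges_p[OF that] by simp
    qed
    have "card (\<Union>p\<in>P. path_edges p) = (\<Sum>p\<in>P. card (path_edges p))"
    proof (rule card_UN_disjoint[OF finP])
      show "\<forall>p\<in>P. finite (path_edges p)"
        using edges_p by simp
      show "\<forall>p\<in>P. \<forall>p'\<in>P. p \<noteq> p' \<longrightarrow> path_edges p \<inter> path_edges p' = {}"
        using assms(8) by (simp add: pairwise_def)
    qed
    also have "\<dots> = card P * 2"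
      using card_path by simp
    finally show "card (\<Union>p\<in>P. path_edges p) = card (edges B1)"
      using assms(3-5,7) by auto
  qed

  \<comment> \<open>The successor function on the paths\<close>
  have "\<exists>p'\<in>P. a p' = z p" if "p \<in> P" for p
  proof -
    have "z p \<in> verts B1"
      using in_edges(2)[OF that] edges_sub by blast
    \<comment> \<open>The far end \<open>z p\<close> is no middle, so it is the start of some path,
      which is taken as \<open>F p\<close>.\<close>
    then show ?thesis
      unfolding verts_eq using z_neq_m[OF that] by (metis UnE imageE)
  qed
  then obtain F where F: "\<And>p. p \<in> P \<Longrightarrow> F p \<in> P \<and> a (F p) = z p"
    by metis
  have edges_F: "path_edges p = {{a p, m p}, {m p, a (F p)}}" if "p \<in> P" for p
    using edges_p F that by simp
  interpret subdivided_functional_graph B1 P F a m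
  proof
    show "edges B1 = (\<Union>p\<in>P. {{a p, m p}, {m p, a (F p)}})"
      unfolding edges_eq using edges_F by (rule SUP_cong[OF refl])
    show "F p \<noteq> p" if "p \<in> P" for p
      using F neq that by metis
  qed (use assms(1) verts_eq inj_a inj_m disj F in auto)

  \<comment> \<open>Parity of the periods and the final colouring\<close>
  have even_k: "even k"
    if p: "p \<in> P" and k: "0 < k" "(F ^^ k) p = p"
      and min: "\<And>l. 0 < l \<Longrightarrow> l < k \<Longrightarrow> (F ^^ l) p \<noteq> p" for p k
  proof -
    define orbit where "orbit = (\<lambda>t. (F ^^ t) p) ` {..<k}"
    obtain c where c: "is_cycle B1 c"
      and c_edges: "cycle_edges c = (\<Union>j\<in>orbit. {{a j, m j}, {m j, a (F j)}})"
      using cycle_of_period[OF p k min] unfolding orbit_def by blast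
    have orbit_sub: "orbit \<subseteq> P"
      unfolding orbit_def using funpow_closed[of P F p] F p by auto
    have edges_c: "cycle_edges c = (\<Union>j\<in>orbit. path_edges j)"
      unfolding c_edges using edges_F orbit_sub by (intro SUP_cong) auto
    \<comment> \<open>A path inside the cycle shares its first edge with a path of the orbit and
      hence equals it. So the cycle contains exactly \<open>k\<close> of the paths.\<close>
    have "p' \<in> orbit" if p': "p' \<in> P" "path_edges p' \<subseteq> cycle_edges c" for p'
    proof -
      have first: "{a p', m p'} \<in> path_edges p'"
        using edges_p[OF p'(1)] by simp
      then obtain j where j: "j \<in> orbit" "{a p', m p'} \<in> path_edges j"
        using p'(2) edges_c by blast
      then have "p' = j"
        using p'(1) orbit_sub first by (intro same_path[of p' j]) auto
      with j show ?thesis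
        by simp
    qed
    then have "{p' \<in> P. path_edges p' \<subseteq> cycle_edges c} = orbit"
      using orbit_sub edges_c by blast
    moreover have "card orbit = k"
      unfolding orbit_def using funpow_inj_below_period[OF k(2) min] by (simp add: card_image)
    ultimately show ?thesis
      using assms(9)[OF c] by simp
  qed
  have "\<exists>col. \<forall>p\<in>P. col (F p) \<longleftrightarrow> \<not> col p"
  proof (rule flipping_colouring_exists)
    show "even k" if "p \<in> P" "0 < k" "(F ^^ k) p = p"
      "\<And>l. 0 < l \<Longrightarrow> l < k \<Longrightarrow> (F ^^ l) p \<noteq> p" for p k
      using that by (rule even_k)
  qed (use F in blast)
  then obtain col where "\<And>p. p \<in> P \<Longrightarrow> col (F p) \<longleftrightarrow> \<not> col p"
    by blast
  then show ?thesis
    by (intro conjI two_variegated_of_colouring two_variegated_line_graph_of_colouring)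
qed

end
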